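(* Let $G$ be a graph on the vertex set $[n]$ with stable sets $S_1,\dots,S_m$, let $K$ be a field, and let $F=x_{i_1}\cdots x_{i_k}-x_{j_1}\cdots x_{j_k}\in K[x_1,\dots,x_m]$ be a homogeneous binomial. Then $F\in I_G$ if and only if there exists $\mathbf a\in\mathbb Z_{\ge0}^n$ such that $\varphi_k(f)=x_{i_1}\cdots x_{i_k}$ and $\varphi_k(g)=x_{j_1}\cdots x_{j_k}$ for some $k$-colorings $f$ and $g$ of $G_{\mathbf a}$. In particular, $$I_G=\big\langle\, \varphi_k(f)-\varphi_k(g) \;:\; f \text{ and } g \text{ are } k\text{-colorings of } G_{\mathbf a} \text{ with } \mathbf a\in\mathbb Z_{\ge0}^n \text{ and } k\ge\chi(G_{\mathbf a})\,\big\rangle .$$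
   Context: Graphs are finite and simple; $[n]=\{1,\dots,n\}$. A $k$-coloring of a graph $H$ is a map $f$ from its vertex set to $[k]$ with $f(u)\ne f(v)$ for every edge $\{u,v\}$ (not necessarily surjective); $\chi(H)$ is the chromatic number. For $\mathbf a=(a_1,\dots,a_n)\in\mathbb Z_{\ge0}^n$, $G_{\mathbf a}$ is the graph obtained from $G$ by replacing each vertex $i$ with a complete graph $G^{(i)}$ on $a_i$ vertices (deleting $i$ if $a_i=0$), and joining every vertex of $G^{(i)}$ to every vertex of $G^{(j)}$ whenever $\{i,j\}$ is an edge of $G$. A stable set of $G$ is a subset of $[n]$ containing no two adjacent vertices (including $\emptyset$); $S_1,\dots,S_m$ are all the stable sets of $G$. The stable set ideal $I_G$ is the kernel of the $K$-algebra homomorphism $K[x_1,\dots,x_m]\to K[t_1,\dots,t_n,s]$, $x_i\mapsto s\prod_{j\in S_i}t_j$. For a $k$-coloring $f$ of $G_{\mathbf a}$, each set $\{j\in[n]: G^{(j)}\cap f^{-1}(\ell)\ne\emptyset\}$ ($\ell=1,\dots,k$) is a stable set of $G$, and one defines the monomial $\varphi_k(f)=x_{i_1}\cdots x_{i_k}$, where $S_{i_\ell}=\{j\in[n]: G^{(j)}\cap f^{-1}(\ell)\neq\emptyset\}$ for $\ell=1,\dots,k$. *)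

theory Defs
  imports "HOL-Algebra.RingHom" "HOL-Library.Poly_Mapping"
begin

record 'a graph =
  verts :: "'a set"
  edges :: "'a set set"

definition simple_graph :: "'a graph \<Rightarrow> bool" where
  "simple_graph H \<longleftrightarrow> finite (verts H) \<and> (\<forall>e\<in>edges H. e \<subseteq> verts H \<and> card e = 2)"

definition stable_sets :: "'a graph \<Rightarrow> 'a set set" where
  "stable_sets H = {A. A \<subseteq> verts H \<and> (\<forall>u\<in>A. \<forall>v\<in>A. {u, v} \<notin> edges H)}"

text \<open>Values of a coloring outside \<^term>\<open>verts H\<close> are irrelevant and left unconstrained.\<close>

definition coloring :: "'a graph \<Rightarrow> nat \<Rightarrow> ('a \<Rightarrow> nat) \<Rightarrow> bool" where
  "coloring H k f \<longleftrightarrow> f \<in> verts H \<rightarrow> {1..k} \<and> (\<forall>u v. {u, v} \<in> edges H \<longrightarrow> f u \<noteq> f v)"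

definition chromatic_number :: "'a graph \<Rightarrow> nat" where
  "chromatic_number H = (LEAST k. \<exists>f. coloring H k f)"

text \<open>\<open>clique a i\<close> is the vertex set of the complete graph replacing \<open>i\<close>; it is empty if \<open>a i = 0\<close>.
  Only the values of \<open>a\<close> on the vertices of \<open>G\<close> enter \<open>blowup G a\<close>.\<close>

definition clique :: "('a \<Rightarrow> nat) \<Rightarrow> 'a \<Rightarrow> ('a \<times> nat) set" where
  "clique a i = {i} \<times> {1..a i}"

definition blowup :: "'a graph \<Rightarrow> ('a \<Rightarrow> nat) \<Rightarrow> ('a \<times> nat) graph" where
  "blowup G a =
    \<lparr> verts = (\<Union>i\<in>verts G. clique a i),
      edges = {{u, v} | u v i. i \<in> verts G \<and> u \<in> clique a i \<and> v \<in> clique a i \<and> u \<noteq> v}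
            \<union> {{u, v} | u v i j. {i, j} \<in> edges G \<and> u \<in> clique a i \<and> v \<in> clique a j} \<rparr>"

definition color_support :: "'a graph \<Rightarrow> ('a \<Rightarrow> nat) \<Rightarrow> ('a \<times> nat \<Rightarrow> nat) \<Rightarrow> nat \<Rightarrow> 'a set" where
  "color_support G a f l = {j \<in> verts G. clique a j \<inter> f -` {l} \<noteq> {}}"

lemma simple_graph_blowup:
  assumes "simple_graph G"
  shows "simple_graph (blowup G a)"
proof -
  have *: "i \<in> verts G \<and> j \<in> verts G \<and> i \<noteq> j" if "{i, j} \<in> edges G" for i j
    using assms that by (auto simp: simple_graph_def)
  show ?thesis
    unfolding simple_graph_def
  proof (intro conjI ballI)
    show "finite (verts (blowup G a))"
      using assms by (auto simp: simple_graph_def blowup_def clique_def)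
  next
    fix e assume "e \<in> edges (blowup G a)"
    then obtain u v where e: "e = {u, v}" and uv: "u \<noteq> v" "u \<in> verts (blowup G a)" "v \<in> verts (blowup G a)"
      using * by (fastforce simp: blowup_def clique_def)
    show "e \<subseteq> verts (blowup G a)" and "card e = 2"
      using e uv by auto
  qed
qed

lemma color_support_stable:
  assumes "simple_graph G" "coloring (blowup G a) k f"
  shows "color_support G a f l \<in> stable_sets G"
proof -
  have False if uv: "u \<in> color_support G a f l" "v \<in> color_support G a f l" "{u, v} \<in> edges G"
    for u v
  proof -
    from uv obtain x y where "x \<in> clique a u" "y \<in> clique a v" "f x = l" "f y = l"
      by (auto simp: color_support_def)
    moreover from this uv(3) have "{x, y} \<in> edges (blowup G a)"
      unfolding blowup_def by (simp del: split_paired_Ex) blast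
    ultimately show False
      using assms(2) unfolding coloring_def by metis
  qed
  then show ?thesis
    by (auto simp: stable_sets_def color_support_def)
qed

text \<open>A polynomial is a finitely supported map from monomials to coefficients, and a monomial is
  a finitely supported map from variables to exponents.\<close>

type_synonym ('v, 'k) mpoly = "('v \<Rightarrow>\<^sub>0 nat) \<Rightarrow>\<^sub>0 'k"

definition Var :: "'v \<Rightarrow> ('v, 'k::comm_ring_1) mpoly" where
  "Var v = Poly_Mapping.single (Poly_Mapping.single v 1) 1"

definition Const :: "'k \<Rightarrow> ('v, 'k::comm_ring_1) mpoly" where
  "Const c = Poly_Mapping.single 0 c"

definition mpoly_ring :: "'v set \<Rightarrow> ('v, 'k::comm_ring_1) mpoly ring" where
  "mpoly_ring V =
    \<lparr> carrier = {p. \<forall>u\<in>Poly_Mapping.keys p. Poly_Mapping.keys u \<subseteq> V},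
      monoid.mult = (*), one = 1, zero = 0, add = (+) \<rparr>"

text \<open>The \<open>'k\<close>-algebra homomorphism sending each variable \<open>v\<close> to \<open>h v\<close>.\<close>

definition mpoly_hom :: "('v \<Rightarrow> ('w, 'k) mpoly) \<Rightarrow> ('v, 'k::comm_ring_1) mpoly \<Rightarrow> ('w, 'k) mpoly" where
  "mpoly_hom h p =
    (\<Sum>u\<in>Poly_Mapping.keys p. Const (Poly_Mapping.lookup p u) *
       (\<Prod>v\<in>Poly_Mapping.keys u. h v ^ Poly_Mapping.lookup u v))"

lemma cring_mpoly_ring: "cring (mpoly_ring V :: ('v, 'k::comm_ring_1) mpoly ring)"
proof -
  let ?R = "mpoly_ring V :: ('v, 'k) mpoly ring"
  have mult: "p * q \<in> carrier ?R" if "p \<in> carrier ?R" "q \<in> carrier ?R" for p q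
  proof -
    have "Poly_Mapping.keys u \<subseteq> V" if u: "u \<in> Poly_Mapping.keys (p * q)" for u
    proof -
      from u keys_mult[of p q] obtain b c
        where "u = b + c" "b \<in> Poly_Mapping.keys p" "c \<in> Poly_Mapping.keys q" by blast
      then show ?thesis
        using \<open>p \<in> carrier ?R\<close> \<open>q \<in> carrier ?R\<close> Poly_Mapping.keys_add[of b c]
        unfolding mpoly_ring_def by force
    qed
    then show ?thesis by (simp add: mpoly_ring_def)
  qed
  have add: "p + q \<in> carrier ?R" if "p \<in> carrier ?R" "q \<in> carrier ?R" for p q
    using that Poly_Mapping.keys_add[of p q] unfolding mpoly_ring_def by force
  have ops: "x \<otimes>\<^bsub>?R\<^esub> y = x * y" "x \<oplus>\<^bsub>?R\<^esub> y = x + y" "\<zero>\<^bsub>?R\<^esub> = 0" "\<one>\<^bsub>?R\<^esub> = 1" for x y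
    by (simp_all add: mpoly_ring_def)
  have zero_one: "0 \<in> carrier ?R" "1 \<in> carrier ?R"
    by (simp_all add: mpoly_ring_def)
  show ?thesis
  proof (rule cringI)
    show "abelian_group ?R"
    proof (rule abelian_groupI)
      fix p assume "p \<in> carrier ?R"
      then show "\<exists>q\<in>carrier ?R. q \<oplus>\<^bsub>?R\<^esub> p = \<zero>\<^bsub>?R\<^esub>"
        unfolding ops by (intro bexI[of _ "- p"]) (simp_all add: mpoly_ring_def)
    qed (simp_all only: ops add zero_one ac_simps add_0_left add_0_right)
    show "comm_monoid ?R"
      by (rule comm_monoidI) (simp_all only: ops mult zero_one ac_simps mult_1_left mult_1_right)
  qed (simp_all only: ops distrib_right)
qed

lemma mpoly_induct [case_names single add]:
  fixes P :: "('a \<Rightarrow>\<^sub>0 'b::monoid_add) \<Rightarrow> bool"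
  assumes "\<And>k v. P (Poly_Mapping.single k v)" and "\<And>p q. P p \<Longrightarrow> P q \<Longrightarrow> P (p + q)"
  shows "P p"
proof (induction p rule: update_induct)
  case const
  show ?case using assms(1)[of undefined 0] by simp
next
  case (update f a b)
  have "Poly_Mapping.update a b f = f + Poly_Mapping.single a b"
    using update(1)
    by (intro poly_mapping_eqI) (auto simp: lookup_update lookup_add lookup_single in_keys_iff when_def)
  then show ?case using assms update.IH by metis
qed

lemma mpoly_hom_superset:
  assumes "finite A" "Poly_Mapping.keys p \<subseteq> A"
  shows "mpoly_hom h p = (\<Sum>u\<in>A. Const (Poly_Mapping.lookup p u) *
           (\<Prod>v\<in>Poly_Mapping.keys u. h v ^ Poly_Mapping.lookup u v))"
  unfolding mpoly_hom_def using assms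
  by (intro sum.mono_neutral_left) (auto simp: Const_def in_keys_iff)

lemma mpoly_hom_add: "mpoly_hom h (p + q) = mpoly_hom h p + mpoly_hom h q"
proof -
  let ?A = "Poly_Mapping.keys p \<union> Poly_Mapping.keys q"
  have "Poly_Mapping.keys (p + q) \<subseteq> ?A"
    by (rule Poly_Mapping.keys_add)
  then show ?thesis
    by (simp add: mpoly_hom_superset[of ?A] Const_def single_add lookup_add distrib_right sum.distrib)
qed

lemma mpoly_hom_single:
  "mpoly_hom h (Poly_Mapping.single u c) =
     Const c * (\<Prod>v\<in>Poly_Mapping.keys u. h v ^ Poly_Mapping.lookup u v)"
  by (subst mpoly_hom_superset[of "{u}"]) (auto simp: Const_def)

lemma mpoly_hom_Const: "mpoly_hom h (Const c) = Const c"
  by (simp add: Const_def mpoly_hom_single)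

lemma mpoly_hom_Var: "mpoly_hom h (Var v) = h v"
  by (simp add: Var_def mpoly_hom_single) (simp add: Const_def)

lemma mpoly_hom_mult: "mpoly_hom h (p * q) = mpoly_hom h p * mpoly_hom h q"
proof -
  have mono: "(\<Prod>v\<in>Poly_Mapping.keys (u + w). h v ^ Poly_Mapping.lookup (u + w) v) =
      (\<Prod>v\<in>Poly_Mapping.keys u. h v ^ Poly_Mapping.lookup u v) *
      (\<Prod>v\<in>Poly_Mapping.keys w. h v ^ Poly_Mapping.lookup w v)" for u w
  proof -
    let ?A = "Poly_Mapping.keys u \<union> Poly_Mapping.keys w"
    have *: "(\<Prod>v\<in>Poly_Mapping.keys x. h v ^ Poly_Mapping.lookup x v) = (\<Prod>v\<in>?A. h v ^ Poly_Mapping.lookup x v)"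
      if "Poly_Mapping.keys x \<subseteq> ?A" for x
      using that by (intro prod.mono_neutral_left) (auto simp: in_keys_iff)
    show ?thesis
      by (subst (1 2 3) *) (auto simp: Poly_Mapping.keys_add lookup_add power_add prod.distrib)
  qed
  have single_single: "mpoly_hom h (Poly_Mapping.single u c * Poly_Mapping.single w d) =
      mpoly_hom h (Poly_Mapping.single u c) * mpoly_hom h (Poly_Mapping.single w d)" for u w c d
    by (simp add: mult_single mpoly_hom_single mono) (simp add: Const_def mult_single[of 0 _ 0, simplified, symmetric] ac_simps)
  have zero: "mpoly_hom h 0 = 0"
    by (simp add: mpoly_hom_def)
  have left: "mpoly_hom h (p * Poly_Mapping.single w d) = mpoly_hom h p * mpoly_hom h (Poly_Mapping.single w d)" for p w d
  proof (induction p rule: mpoly_induct)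
    case (single k v)
    then show ?case by (rule single_single)
  next
    case (add p q)
    then show ?case by (simp add: mpoly_hom_add distrib_right)
  qed
  show ?thesis
  proof (induction q rule: mpoly_induct)
    case (single k v)
    then show ?case by (rule left)
  next
    case (add p q)
    then show ?case by (simp add: mpoly_hom_add distrib_left)
  qed
qed

datatype 'a target_var = TVar 'a | SVar

text \<open>The family \<open>st\<close> enumerates the stable sets of \<open>G\<close> as \<open>st 1, \<dots>, st m\<close>; the variables
  of the source ring are their indices.\<close>

definition stable_set_hom :: "(nat \<Rightarrow> 'a set) \<Rightarrow> (nat, 'k) mpoly \<Rightarrow> ('a target_var, 'k::comm_ring_1) mpoly"
  where "stable_set_hom st = mpoly_hom (\<lambda>i. Var SVar * (\<Prod>j\<in>st i. Var (TVar j)))"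

definition stable_set_ideal :: "'a graph \<Rightarrow> nat \<Rightarrow> (nat \<Rightarrow> 'a set) \<Rightarrow> (nat, 'k::comm_ring_1) mpoly set"
  where "stable_set_ideal G m st =
    a_kernel (mpoly_ring {1..m}) (mpoly_ring (TVar ` verts G \<union> {SVar})) (stable_set_hom st)"

text \<open>The product below is over the colors; \<open>the_inv_into {1..m} st A\<close> is the index of the stable
  set \<open>A\<close>.\<close>

definition coloring_monomial ::
    "'a graph \<Rightarrow> nat \<Rightarrow> (nat \<Rightarrow> 'a set) \<Rightarrow> ('a \<Rightarrow> nat) \<Rightarrow> nat \<Rightarrow> ('a \<times> nat \<Rightarrow> nat) \<Rightarrow> (nat, 'k::comm_ring_1) mpoly"
  where "coloring_monomial G m st a k f =
    (\<Prod>l = 1..k. Var (the_inv_into {1..m} st (color_support G a f l)))"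

end

theory Submission
  imports Defs
begin

text \<open>
  Everything reduces to counting how often a vertex is covered by a family of stable sets.  The
  homomorphism \<^const>\<open>stable_set_hom\<close> sends a product of variables, one for each of the stable sets
  \<open>S\<^sub>1, \<dots>, S\<^sub>k\<close>, to the monomial \<open>s\<^sup>k \<cdot> \<Prod>\<^sub>v t\<^sub>v ^ c v\<close>, where \<open>c v\<close> is the number of colors
  \<open>l\<close> with \<open>v \<in> S\<^sub>l\<close>.  Hence a homogeneous binomial of degree \<open>k\<close> lies in the stable set ideal iff
  its two families have the same cover counts (\<open>binomial_in_stable_set_ideal_iff\<close>).

  On the other side, a \<open>k\<close>-coloring of the blowup of \<open>G\<close> by \<open>a\<close> uses exactly \<open>a v\<close> colors on the
  clique of \<open>v\<close>, so its supports have cover counts \<open>a\<close> (\<open>card_colors_of_vertex\<close>).  Conversely every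
  family of \<open>k\<close> stable sets with cover counts \<open>a\<close> is the family of supports of such a coloring: the
  clique of \<open>v\<close> is colored bijectively by the colors whose stable set contains \<open>v\<close>
  (\<open>coloring_with_supports\<close>).  Two families with the same counts \<open>a\<close> are therefore the same thing as
  two colorings of one blowup, which is the first claim.

  For the second claim, the kernel of a homomorphism that sends monomials to monomials is generated
  by the differences of two monomials with the same image (\<open>kernel_of_monomial_hom_in_ideal\<close>).  The
  variable \<open>s\<close> records the degree, so these differences are homogeneous, and the first claim turns each
  of them into a generator.  The bound by the chromatic number holds whenever a \<open>k\<close>-coloring exists.
\<close>

section \<open>Polynomial rings and monomial homomorphisms\<close>

lemma mpoly_ring_simps:
  "x \<otimes>\<^bsub>mpoly_ring V\<^esub> y = x * y" "x \<oplus>\<^bsub>mpoly_ring V\<^esub> y = x + y"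
  "\<zero>\<^bsub>mpoly_ring V\<^esub> = 0" "\<one>\<^bsub>mpoly_ring V\<^esub> = 1"
  by (simp_all add: mpoly_ring_def)

lemma ring_mpoly_ring: "ring (mpoly_ring V :: ('v, 'k::comm_ring_1) mpoly ring)"
  using cring_mpoly_ring by (rule cring.axioms)

lemma single_in_mpoly_ring:
  "Poly_Mapping.keys u \<subseteq> V \<Longrightarrow> Poly_Mapping.single u c \<in> carrier (mpoly_ring V)"
  by (simp add: mpoly_ring_def)

lemma Var_in_mpoly_ring: "v \<in> V \<Longrightarrow> Var v \<in> carrier (mpoly_ring V)"
  by (simp add: Var_def single_in_mpoly_ring)

lemma Const_in_mpoly_ring: "Const c \<in> carrier (mpoly_ring V)"
  by (simp add: Const_def single_in_mpoly_ring)

lemma mpoly_ring_add: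
  fixes p q :: "('v, 'k::comm_ring_1) mpoly"
  shows "p \<in> carrier (mpoly_ring V) \<Longrightarrow> q \<in> carrier (mpoly_ring V) \<Longrightarrow> p + q \<in> carrier (mpoly_ring V)"
  using ring.ring_simprules(1)[OF ring_mpoly_ring] by (simp add: mpoly_ring_simps)

lemma mpoly_ring_diff:
  fixes p q :: "('v, 'k::comm_ring_1) mpoly"
  shows "p \<in> carrier (mpoly_ring V) \<Longrightarrow> q \<in> carrier (mpoly_ring V) \<Longrightarrow> p - q \<in> carrier (mpoly_ring V)"
  using mpoly_ring_add[of p V "- q"] by (simp add: mpoly_ring_def)

lemma mpoly_ring_mult:
  fixes p q :: "('v, 'k::comm_ring_1) mpoly"
  shows "p \<in> carrier (mpoly_ring V) \<Longrightarrow> q \<in> carrier (mpoly_ring V) \<Longrightarrow> p * q \<in> carrier (mpoly_ring V)"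
  using ring.ring_simprules(5)[OF ring_mpoly_ring] by (simp add: mpoly_ring_simps)

lemma mpoly_ring_sum:
  fixes p :: "'i \<Rightarrow> ('v, 'k::comm_ring_1) mpoly"
  shows "(\<And>i. i \<in> A \<Longrightarrow> p i \<in> carrier (mpoly_ring V)) \<Longrightarrow> sum p A \<in> carrier (mpoly_ring V)"
  by (induction A rule: infinite_finite_induct) (simp_all add: mpoly_ring_add, simp_all add: mpoly_ring_def)

lemma mpoly_ring_prod:
  fixes p :: "'i \<Rightarrow> ('v, 'k::comm_ring_1) mpoly"
  shows "(\<And>i. i \<in> A \<Longrightarrow> p i \<in> carrier (mpoly_ring V)) \<Longrightarrow> prod p A \<in> carrier (mpoly_ring V)"
  by (induction A rule: infinite_finite_induct) (simp_all add: mpoly_ring_mult, simp_all add: mpoly_ring_def)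

lemma mpoly_hom_prod: "mpoly_hom h (prod p A) = (\<Prod>i\<in>A. mpoly_hom h (p i))"
proof -
  have "mpoly_hom h 1 = 1"
    using mpoly_hom_Const[of h 1] by (simp add: Const_def)
  then show ?thesis
    by (induction A rule: infinite_finite_induct) (simp_all add: mpoly_hom_mult)
qed

lemma mpoly_hom_diff: "mpoly_hom h (p - q) = mpoly_hom h p - mpoly_hom h q"
  using mpoly_hom_add[of h "p - q" q] by simp

lemma mpoly_hom_in_ring_hom:
  fixes h :: "'v \<Rightarrow> ('w, 'k::comm_ring_1) mpoly"
  assumes "\<And>v. v \<in> V \<Longrightarrow> h v \<in> carrier (mpoly_ring W)"
  shows "mpoly_hom h \<in> ring_hom (mpoly_ring V) (mpoly_ring W)"
proof (rule ring_hom_memI)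
  have pow: "q ^ e \<in> carrier (mpoly_ring W)" if "q \<in> carrier (mpoly_ring W)"
    for q :: "('w, 'k) mpoly" and e
    using that mpoly_ring_prod[of "{..<e}" "\<lambda>_. q"] by simp
  fix p :: "('v, 'k) mpoly" assume "p \<in> carrier (mpoly_ring V)"
  then show "mpoly_hom h p \<in> carrier (mpoly_ring W)"
    unfolding mpoly_hom_def mpoly_ring_def[of V] using assms
    by (intro mpoly_ring_sum mpoly_ring_mult mpoly_ring_prod Const_in_mpoly_ring pow) auto
next
  show "mpoly_hom h \<one>\<^bsub>mpoly_ring V\<^esub> = \<one>\<^bsub>mpoly_ring W\<^esub>"
    using mpoly_hom_prod[of h _ "{}"] by (simp add: mpoly_ring_simps)
qed (simp_all add: mpoly_ring_simps mpoly_hom_mult mpoly_hom_add)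

lemma prod_single_one:
  "(\<Prod>l\<in>L. Poly_Mapping.single (w l) (1::'k::comm_ring_1)) = Poly_Mapping.single (\<Sum>l\<in>L. w l) 1"
  by (induction L rule: infinite_finite_induct) (simp_all add: mult_single)

text \<open>Passes from exponent vectors, which carry the general theory, to products indexed by \<open>1..k\<close>,
  in which form monomials appear in the coloring statements.\<close>

lemma monomial_eq_prod_Var:
  fixes u :: "'v \<Rightarrow>\<^sub>0 nat"
  obtains k :: nat and i where "i \<in> {1..k} \<rightarrow> Poly_Mapping.keys u"
    and "Poly_Mapping.single u (1::'k::comm_ring_1) = (\<Prod>l = 1..k. Var (i l))"
proof -
  have "\<exists>xs. u = (\<Sum>x\<leftarrow>xs. Poly_Mapping.single x 1)"
  proof (induction u rule: mpoly_induct)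
    case (single v e)
    have "Poly_Mapping.single v e' = (\<Sum>x\<leftarrow>replicate e' v. Poly_Mapping.single x 1)" for e'
    proof (induction e')
      case (Suc d)
      have "Poly_Mapping.single v (Suc d) = Poly_Mapping.single v 1 + Poly_Mapping.single v d"
        by (simp add: single_add[symmetric])
      then show ?case using Suc.IH by simp
    qed simp
    from this[of e]
    show ?case ..
  next
    case (add p q)
    then obtain xs ys where "p = (\<Sum>x\<leftarrow>xs. Poly_Mapping.single x 1)"
      "q = (\<Sum>x\<leftarrow>ys. Poly_Mapping.single x 1)" by blast
    then have "p + q = (\<Sum>x\<leftarrow>xs @ ys. Poly_Mapping.single x 1)" by simp
    then show ?case ..
  qed
  then obtain xs where xs: "u = (\<Sum>x\<leftarrow>xs. Poly_Mapping.single x 1)" ..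
  define i where "i l = xs ! (l - 1)" for l
  have "u = (\<Sum>l<length xs. Poly_Mapping.single (xs ! l) 1)"
    by (simp add: xs sum_list_sum_nth atLeast0LessThan)
  also have "\<dots> = (\<Sum>l = 1..length xs. Poly_Mapping.single (i l) 1)"
    by (rule sum.reindex_bij_witness[of _ "\<lambda>l. l - 1" Suc]) (auto simp: i_def)
  finally have u: "u = (\<Sum>l = 1..length xs. Poly_Mapping.single (i l) 1)" .
  show thesis
  proof
    show "Poly_Mapping.single u (1::'k) = (\<Prod>l = 1..length xs. Var (i l))"
      by (subst u) (simp add: Var_def prod_single_one)
    show "i \<in> {1..length xs} \<rightarrow> Poly_Mapping.keys u"
    proof
      fix l assume l: "l \<in> {1..length xs}"
      show "i l \<in> Poly_Mapping.keys u"
        using l by (auto simp: in_keys_iff u lookup_sum intro!: bexI[of _ l])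
    qed
  qed
qed

text \<open>Group the terms of \<open>p\<close> by the image \<open>T u\<close> of their monomial.  As distinct monomials of the target
  are linearly independent, \<open>p\<close> is in the kernel iff the coefficients in each group add up to \<open>0\<close>.
  Replacing every monomial of a group by one fixed representative then gives \<open>0\<close>, so \<open>p\<close> equals
  the sum of the differences made by these replacements, each a multiple of a binomial in \<open>J\<close>.\<close>

lemma kernel_of_monomial_hom_in_ideal:
  fixes h :: "'v \<Rightarrow> ('w, 'k::comm_ring_1) mpoly"
  assumes J: "ideal J (mpoly_ring V)"
    and p: "p \<in> carrier (mpoly_ring V)" "mpoly_hom h p = 0"
    and T: "\<And>u. Poly_Mapping.keys u \<subseteq> V \<Longrightarrow>
        mpoly_hom h (Poly_Mapping.single u 1) = Poly_Mapping.single (T u) 1"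
    and binom: "\<And>u v. Poly_Mapping.keys u \<subseteq> V \<Longrightarrow> Poly_Mapping.keys v \<subseteq> V \<Longrightarrow> T u = T v \<Longrightarrow>
        Poly_Mapping.single u 1 - Poly_Mapping.single v 1 \<in> J"
  shows "p \<in> J"
proof -
  let ?S = "Poly_Mapping.keys p" and ?c = "Poly_Mapping.lookup p"
  define rep where "rep t = (SOME u. u \<in> ?S \<and> T u = t)" for t
  have rep: "rep (T u) \<in> ?S \<and> T (rep (T u)) = T u" if "u \<in> ?S" for u
    unfolding rep_def by (rule someI[of _ u]) (simp add: that)
  have V: "Poly_Mapping.keys u \<subseteq> V" if "u \<in> ?S" for u
    using that p(1) by (simp add: mpoly_ring_def)
  have hom_sum: "mpoly_hom h (sum q A) = (\<Sum>i\<in>A. mpoly_hom h (q i))" for q and A :: "('v \<Rightarrow>\<^sub>0 nat) set"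
    by (induction A rule: infinite_finite_induct) (simp_all add: mpoly_hom_add, simp_all add: mpoly_hom_def)
  have scale: "Const c * Poly_Mapping.single u 1 = Poly_Mapping.single u c" for c :: 'k and u :: "'x \<Rightarrow>\<^sub>0 nat"
    by (simp add: Const_def mult_single)
  have single_sum: "(\<Sum>u\<in>A. Poly_Mapping.single v (c u)) = Poly_Mapping.single v (\<Sum>u\<in>A. c u)"
    for v :: "'v \<Rightarrow>\<^sub>0 nat" and c :: "('v \<Rightarrow>\<^sub>0 nat) \<Rightarrow> 'k" and A
    by (induction A rule: infinite_finite_induct) (simp_all add: single_add)
  have p_eq: "p = (\<Sum>u\<in>?S. Poly_Mapping.single u (?c u))"
    by (rule poly_mapping_eqI) (auto simp: lookup_sum lookup_single when_def in_keys_iff)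
  have "mpoly_hom h (Poly_Mapping.single u (?c u)) = Poly_Mapping.single (T u) (?c u)" if "u \<in> ?S" for u
    using T[OF V[OF that]] by (metis mpoly_hom_Const mpoly_hom_mult scale)
  then have image: "(\<Sum>u\<in>?S. Poly_Mapping.single (T u) (?c u)) = 0"
    using p(2) by (subst (asm) p_eq) (simp add: hom_sum)
  have fibre: "(\<Sum>u | u \<in> ?S \<and> T u = t. ?c u) = 0" for t
    using arg_cong[OF image, of "\<lambda>q. Poly_Mapping.lookup q t"]
    by (simp add: lookup_sum lookup_single when_def sum.If_cases Int_def)
  have "(\<Sum>u\<in>?S. Poly_Mapping.single (rep (T u)) (?c u))
      = (\<Sum>t\<in>T ` ?S. \<Sum>u | u \<in> ?S \<and> T u = t. Poly_Mapping.single (rep (T u)) (?c u))"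
    by (rule sum.group[symmetric]) auto
  also have "\<dots> = (\<Sum>t\<in>T ` ?S. Poly_Mapping.single (rep t) (\<Sum>u | u \<in> ?S \<and> T u = t. ?c u))"
    by (simp add: single_sum[symmetric])
  also have "\<dots> = 0"
    by (simp add: fibre)
  finally have "p = (\<Sum>u\<in>?S. Poly_Mapping.single u (?c u))
      - (\<Sum>u\<in>?S. Poly_Mapping.single (rep (T u)) (?c u))"
    using p_eq by simp
  also have "\<dots> = (\<Sum>u\<in>?S. Const (?c u) * (Poly_Mapping.single u 1 - Poly_Mapping.single (rep (T u)) 1))"
    by (simp add: right_diff_distrib scale sum_subtractf)
  also have "\<dots> \<in> J"
  proof -
    have add: "x + y \<in> J" if "x \<in> J" "y \<in> J" for x y
      using additive_subgroup.a_closed[OF ideal.axioms(1)[OF J] that] by (simp add: mpoly_ring_simps)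
    have zero: "0 \<in> J"
      using additive_subgroup.zero_closed[OF ideal.axioms(1)[OF J]] by (simp add: mpoly_ring_simps)
    have mult: "Const c * x \<in> J" if "x \<in> J" for c x
      using ideal.I_l_closed[OF J that Const_in_mpoly_ring] by (simp add: mpoly_ring_simps)
    have sums: "sum q A \<in> J" if "\<And>u. u \<in> A \<Longrightarrow> q u \<in> J" for q and A :: "('v \<Rightarrow>\<^sub>0 nat) set"
      using that by (induction A rule: infinite_finite_induct) (simp_all add: add zero)
    show ?thesis
      using rep V by (intro sums mult binom) auto
  qed
  finally show ?thesis .
qed

section \<open>The exponent vector of a family of stable sets\<close>

text \<open>The exponent vector of \<open>s \<cdot> \<Prod>\<^sub>j t\<^sub>j\<close> with \<open>j\<close> ranging over \<open>A\<close>, the image of the variable of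
  the stable set \<open>A\<close>.\<close>

definition stable_weight :: "'a set \<Rightarrow> 'a target_var \<Rightarrow>\<^sub>0 nat" where
  "stable_weight A = Poly_Mapping.single SVar 1 + (\<Sum>j\<in>A. Poly_Mapping.single (TVar j) 1)"

text \<open>The exponent of \<open>s\<close> is the size of the family, that of \<open>t\<^sub>v\<close> is the number of members that
  contain \<open>v\<close>.  Finiteness matters because the sum defining \<^const>\<open>stable_weight\<close> is \<open>0\<close> for an
  infinite set.\<close>

lemma sum_stable_weight_eq_iff:
  fixes S S' :: "'l \<Rightarrow> 'a set"
  assumes "finite L" "finite L'" "\<And>l. l \<in> L \<Longrightarrow> finite (S l)" "\<And>l. l \<in> L' \<Longrightarrow> finite (S' l)"
  shows "(\<Sum>l\<in>L. stable_weight (S l)) = (\<Sum>l\<in>L'. stable_weight (S' l)) \<longleftrightarrow>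
    card L = card L' \<and> (\<forall>v. card {l \<in> L. v \<in> S l} = card {l \<in> L'. v \<in> S' l})"
proof -
  have SVar: "Poly_Mapping.lookup (stable_weight A) SVar = 1" for A :: "'a set"
    by (simp add: stable_weight_def lookup_add lookup_sum lookup_single)
  have TVar: "Poly_Mapping.lookup (stable_weight A) (TVar v) = (if v \<in> A then 1 else 0)"
    if "finite A" for A :: "'a set" and v
    using that by (simp add: stable_weight_def lookup_add lookup_sum lookup_single when_def)
  have count: "Poly_Mapping.lookup (\<Sum>l\<in>M. stable_weight (R l)) (TVar v) = card {l \<in> M. v \<in> R l}"
    if "finite M" "\<And>l. l \<in> M \<Longrightarrow> finite (R l)" for M :: "'l set" and R :: "'l \<Rightarrow> 'a set" and v
  proof -
    have "Poly_Mapping.lookup (\<Sum>l\<in>M. stable_weight (R l)) (TVar v) = (\<Sum>l\<in>M. if v \<in> R l then 1 else 0)"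
      unfolding lookup_sum using that by (intro sum.cong) (simp_all add: TVar)
    also have "\<dots> = card {l \<in> M. v \<in> R l}"
      using that by (simp add: sum.If_cases Int_def)
    finally show ?thesis .
  qed
  have eq_iff: "x = y \<longleftrightarrow> Poly_Mapping.lookup x SVar = Poly_Mapping.lookup y SVar \<and>
      (\<forall>v. Poly_Mapping.lookup x (TVar v) = Poly_Mapping.lookup y (TVar v))"
    for x y :: "'a target_var \<Rightarrow>\<^sub>0 nat"
    by (metis poly_mapping_eqI target_var.exhaust)
  show ?thesis
    unfolding eq_iff using assms by (simp add: count[unfolded lookup_sum] lookup_sum SVar)
qed

lemma stable_set_hom_prod_Var:
  "stable_set_hom st (\<Prod>l\<in>L. Var (i l)) =
     Poly_Mapping.single (\<Sum>l\<in>L. stable_weight (st (i l))) (1::'k::comm_ring_1)"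
proof -
  have "stable_set_hom st (Var v) = Poly_Mapping.single (stable_weight (st v)) (1::'k)" for v
    unfolding stable_set_hom_def
    by (simp add: mpoly_hom_Var) (simp add: stable_weight_def Var_def prod_single_one mult_single)
  then show ?thesis
    by (simp add: stable_set_hom_def mpoly_hom_prod prod_single_one)
qed

lemma finite_stable_set: "simple_graph G \<Longrightarrow> A \<in> stable_sets G \<Longrightarrow> finite A"
  by (auto simp: simple_graph_def stable_sets_def intro: finite_subset)

lemma ideal_stable_set_ideal:
  assumes "simple_graph G" "bij_betw st {1..m} (stable_sets G)"
  shows "ideal (stable_set_ideal G m st :: (nat, 'k::comm_ring_1) mpoly set) (mpoly_ring {1..m})"
proof -
  have "stable_set_hom st \<in> ring_hom (mpoly_ring {1..m} :: (nat, 'k) mpoly ring)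
      (mpoly_ring (TVar ` verts G \<union> {SVar}))"
    unfolding stable_set_hom_def
  proof (rule mpoly_hom_in_ring_hom)
    fix v assume "v \<in> {1..m}"
    then have "st v \<subseteq> verts G"
      using assms(2) by (auto simp: bij_betw_def stable_sets_def)
    then show "Var SVar * (\<Prod>j\<in>st v. Var (TVar j)) \<in> carrier (mpoly_ring (TVar ` verts G \<union> {SVar}))"
      by (intro mpoly_ring_mult mpoly_ring_prod Var_in_mpoly_ring) auto
  qed
  then have "ring_hom_ring (mpoly_ring {1..m} :: (nat, 'k) mpoly ring)
      (mpoly_ring (TVar ` verts G \<union> {SVar})) (stable_set_hom st)"
    by (intro ring_hom_ringI2 ring_mpoly_ring)
  then show ?thesis
    unfolding stable_set_ideal_def by (rule ring_hom_ring.kernel_is_ideal)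
qed

lemma stable_set_ideal_iff:
  "p \<in> stable_set_ideal G m st \<longleftrightarrow> p \<in> carrier (mpoly_ring {1..m}) \<and> stable_set_hom st p = 0"
  by (simp add: stable_set_ideal_def a_kernel_def' mpoly_ring_simps)

text \<open>Both monomials go to single monomials with coefficient \<open>1\<close>, so the difference is in the kernel iff
  the two exponent vectors agree.  They agree at \<open>s\<close> by homogeneity, which leaves the vertices.\<close>

lemma binomial_in_stable_set_ideal_iff:
  fixes G :: "'a graph" and k :: nat
  assumes G: "simple_graph G" and st: "bij_betw st {1..m} (stable_sets G)"
    and i: "i \<in> {1..k} \<rightarrow> {1..m}" and j: "j \<in> {1..k} \<rightarrow> {1..m}"
  shows "(\<Prod>l = 1..k. Var (i l)) - (\<Prod>l = 1..k. Var (j l))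
        \<in> (stable_set_ideal G m st :: (nat, 'k::comm_ring_1) mpoly set) \<longleftrightarrow>
    (\<forall>v. card {l \<in> {1..k}. v \<in> st (i l)} = card {l \<in> {1..k}. v \<in> st (j l)})"
proof -
  have fin: "finite (st v)" if "v \<in> {1..m}" for v
    using st G that by (auto simp: bij_betw_def intro: finite_stable_set)
  have "(\<Prod>l = 1..k. Var (i l)) - (\<Prod>l = 1..k. Var (j l))
      \<in> (carrier (mpoly_ring {1..m}) :: (nat, 'k) mpoly set)"
    using i j by (intro mpoly_ring_diff mpoly_ring_prod Var_in_mpoly_ring) auto
  moreover have "stable_set_hom st ((\<Prod>l = 1..k. Var (i l)) - (\<Prod>l = 1..k. Var (j l))) =
      Poly_Mapping.single (\<Sum>l = 1..k. stable_weight (st (i l))) (1::'k)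
      - Poly_Mapping.single (\<Sum>l = 1..k. stable_weight (st (j l))) 1"
    by (simp add: stable_set_hom_prod_Var[symmetric]) (simp add: stable_set_hom_def mpoly_hom_diff)
  moreover have "(\<Sum>l = 1..k. stable_weight (st (i l))) = (\<Sum>l = 1..k. stable_weight (st (j l))) \<longleftrightarrow>
      (\<forall>v. card {l \<in> {1..k}. v \<in> st (i l)} = card {l \<in> {1..k}. v \<in> st (j l)})"
    using i j fin by (subst sum_stable_weight_eq_iff) (auto simp: Pi_def)
  moreover have "Poly_Mapping.single x (1::'k) = Poly_Mapping.single y 1 \<longleftrightarrow> x = y"
    for x y :: "'a target_var \<Rightarrow>\<^sub>0 nat"
    by (metis lookup_single_eq lookup_single_not_eq zero_neq_one)
  ultimately show ?thesis
    by (simp add: stable_set_ideal_iff)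
qed

section \<open>Colorings of blowups as families of stable sets\<close>

text \<open>The colors seen by \<open>v\<close> are those used on its clique, and a proper coloring is injective on a
  clique, which has \<open>a v\<close> vertices.\<close>

lemma card_colors_of_vertex:
  assumes f: "coloring (blowup G a) k f" and v: "v \<in> verts G"
  shows "card {l \<in> {1..k}. v \<in> color_support G a f l} = a v"
proof -
  have "{l \<in> {1..k}. v \<in> color_support G a f l} = f ` clique a v"
    using f v by (auto simp: coloring_def color_support_def blowup_def Pi_def)
  moreover have "inj_on f (clique a v)"
  proof (rule inj_onI, rule ccontr)
    fix x y assume xy: "x \<in> clique a v" "y \<in> clique a v" "f x = f y" "x \<noteq> y"
    then have "{x, y} \<in> edges (blowup G a)"
      using v by (simp add: blowup_def del: split_paired_Ex) blast
    then show False
      using f xy(3) unfolding coloring_def by metis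
  qed
  ultimately show ?thesis
    by (simp add: card_image clique_def)
qed

text \<open>The hypothesis on \<open>a\<close> says that the clique of \<open>v\<close> has as many vertices as there are colors
  \<open>l\<close> with \<open>v \<in> S l\<close>, so it can be colored bijectively by these.  The coloring is injective on each
  clique, and two vertices in cliques of adjacent \<open>v\<close> and \<open>w\<close> never share a color \<open>l\<close>, since \<open>S l\<close>
  would contain the edge.\<close>

lemma coloring_with_supports:
  assumes G: "simple_graph G" and S: "\<And>l. l \<in> {1..k} \<Longrightarrow> S l \<in> stable_sets G"
    and a: "\<And>v. a v = card {l \<in> {1..k}. v \<in> S l}"
  obtains f where "coloring (blowup G a) k f"
    and "\<And>l. l \<in> {1..k} \<Longrightarrow> color_support G a f l = S l"
proof -
  have "\<exists>e. bij_betw e {1..a v} {l \<in> {1..k}. v \<in> S l}" for v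
    using ex_bij_betw_nat_finite_1[of "{l \<in> {1..k}. v \<in> S l}"] a by simp
  then obtain e where e: "\<And>v. bij_betw (e v) {1..a v} {l \<in> {1..k}. v \<in> S l}"
    by metis
  define f where "f x = e (fst x) (snd x)" for x
  have f_clique: "f ` clique a v = {l \<in> {1..k}. v \<in> S l}" for v
  proof -
    have "clique a v = Pair v ` {1..a v}"
      by (auto simp: clique_def)
    then have "f ` clique a v = e v ` {1..a v}"
      by (simp add: f_def image_image)
    then show ?thesis
      using e[of v] by (simp add: bij_betw_def)
  qed
  have f_inj: "inj_on f (clique a v)" for v
    unfolding inj_on_def
  proof (intro ballI impI)
    fix x y assume "x \<in> clique a v" "y \<in> clique a v" and eq: "f x = f y"
    then obtain s t where st: "x = (v, s)" "y = (v, t)" "s \<in> {1..a v}" "t \<in> {1..a v}"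
      unfolding clique_def by blast
    then have "e v s = e v t" using eq by (simp only: f_def fst_conv snd_conv)
    then have "s = t" by (rule inj_onD[OF bij_betw_imp_inj_on[OF e]]) (rule st)+
    then show "x = y" using st by (simp only:)
  qed
  show thesis
  proof
    have range: "f x \<in> {1..k} \<and> v \<in> S (f x)" if "x \<in> clique a v" for x v
      using f_clique[of v] that by blast
    have proper: "f x \<noteq> f y" if xy: "{x, y} \<in> edges (blowup G a)" for x y
    proof -
      consider (same) v where "x \<in> clique a v" "y \<in> clique a v" "x \<noteq> y"
        | (edge) v w where "{v, w} \<in> edges G" "x \<in> clique a v" "y \<in> clique a w"
      proof -
        from xy consider (clique) u v i where "{x, y} = {u, v}" "u \<in> clique a i" "v \<in> clique a i" "u \<noteq> v"
          | (cross) u v i j where "{x, y} = {u, v}" "{i, j} \<in> edges G" "u \<in> clique a i" "v \<in> clique a j"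
          unfolding blowup_def graph.select_convs Un_iff mem_Collect_eq by blast
        then show thesis
        proof cases
          case clique
          then show thesis using same unfolding doubleton_eq_iff by blast
        next
          case cross
          from cross(2) have "{j, i} \<in> edges G"
            by (simp add: insert_commute)
          then show thesis
            using edge cross doubleton_eq_iff[of x y u v] by blast
        qed
      qed
      then show ?thesis
      proof cases
        case same
        then show ?thesis using f_inj[of v] inj_onD by metis
      next
        case edge
        then show ?thesis
          using range[of x v] range[of y w] S[of "f x"] by (auto simp: stable_sets_def)
      qed
    qed
    show "coloring (blowup G a) k f"
      using range proper by (auto simp: coloring_def blowup_def)
  next
    fix l assume l: "l \<in> {1..k}"
    have "S l \<subseteq> verts G"
      using S[OF l] by (simp add: stable_sets_def)
    moreover have "clique a v \<inter> f -` {l} \<noteq> {} \<longleftrightarrow> l \<in> f ` clique a v" for v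
      by auto
    ultimately show "color_support G a f l = S l"
      using l by (auto simp: color_support_def f_clique)
  qed
qed

section \<open>Coloring monomials and the stable set ideal\<close>

text \<open>The supports of both colorings cover each vertex \<open>v\<close> of \<open>G\<close> exactly \<open>a v\<close> times.\<close>

lemma coloring_monomial_diff_in_stable_set_ideal:
  assumes G: "simple_graph G" and st: "bij_betw st {1..m} (stable_sets G)"
    and fg: "coloring (blowup G a) k f" "coloring (blowup G a) k g"
  shows "coloring_monomial G m st a k f - coloring_monomial G m st a k g
    \<in> (stable_set_ideal G m st :: (nat, 'k::comm_ring_1) mpoly set)"
proof -
  let ?ix = "\<lambda>f l. the_inv_into {1..m} st (color_support G a f l)"
  have ix: "?ix f l \<in> {1..m} \<and> st (?ix f l) = color_support G a f l"
    if "coloring (blowup G a) k f" for f l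
    using color_support_stable[OF G that] st
    by (metis bij_betw_def f_the_inv_into_f order_refl the_inv_into_into)
  have "card {l \<in> {1..k}. v \<in> color_support G a f l} = card {l \<in> {1..k}. v \<in> color_support G a g l}" for v
  proof (cases "v \<in> verts G")
    case True
    then show ?thesis by (simp only: card_colors_of_vertex[OF fg(1)] card_colors_of_vertex[OF fg(2)])
  qed (simp add: color_support_def)
  moreover have "?ix f \<in> {1..k} \<rightarrow> {1..m}" "?ix g \<in> {1..k} \<rightarrow> {1..m}"
    using ix[OF fg(1)] ix[OF fg(2)] by auto
  ultimately show ?thesis
    unfolding coloring_monomial_def using ix[OF fg(1)] ix[OF fg(2)]
    by (subst binomial_in_stable_set_ideal_iff[OF G st]) simp_all
qed

text \<open>The vector \<open>a\<close> is the common cover count of the two families; each family is then realized as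
  the supports of a coloring of the same blowup.\<close>

lemma colorings_of_binomial:
  assumes G: "simple_graph G" and st: "bij_betw st {1..m} (stable_sets G)"
    and i: "i \<in> {1..k} \<rightarrow> {1..m}" and j: "j \<in> {1..k} \<rightarrow> {1..m}"
    and F: "(\<Prod>l = 1..k. Var (i l)) - (\<Prod>l = 1..k. Var (j l))
      \<in> (stable_set_ideal G m st :: (nat, 'k::comm_ring_1) mpoly set)"
  obtains a f g where "coloring (blowup G a) k f" "coloring (blowup G a) k g"
    "coloring_monomial G m st a k f = (\<Prod>l = 1..k. Var (i l) :: (nat, 'k) mpoly)"
    "coloring_monomial G m st a k g = (\<Prod>l = 1..k. Var (j l) :: (nat, 'k) mpoly)"
proof -
  define a where "a v = card {l \<in> {1..k}. v \<in> st (i l)}" for v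
  have "\<exists>f. coloring (blowup G a) k f \<and>
      coloring_monomial G m st a k f = (\<Prod>l = 1..k. Var (x l) :: (nat, 'k) mpoly)"
    if x: "x \<in> {1..k} \<rightarrow> {1..m}" and a: "\<And>v. a v = card {l \<in> {1..k}. v \<in> st (x l)}" for x
  proof -
    have "st (x l) \<in> stable_sets G" if "l \<in> {1..k}" for l
      using st x that unfolding bij_betw_def by blast
    then obtain f where f: "coloring (blowup G a) k f"
      "\<And>l. l \<in> {1..k} \<Longrightarrow> color_support G a f l = st (x l)"
      using coloring_with_supports[OF G, of k "\<lambda>l. st (x l)" a] a by blast
    have "the_inv_into {1..m} st (st (x l)) = x l" if "l \<in> {1..k}" for l
      using st x that by (intro the_inv_into_f_f) (auto simp: bij_betw_def)
    then have "coloring_monomial G m st a k f = (\<Prod>l = 1..k. Var (x l) :: (nat, 'k) mpoly)"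
      unfolding coloring_monomial_def by (intro prod.cong) (simp_all add: f(2))
    with f(1) show ?thesis by blast
  qed
  moreover have "a v = card {l \<in> {1..k}. v \<in> st (j l)}" for v
    using F unfolding binomial_in_stable_set_ideal_iff[OF G st i j] a_def by blast
  ultimately show thesis
    using that i j a_def by meson
qed

text \<open>Two monomials with the same image have the same degree, because the exponent of \<open>s\<close> in the image
  is the degree.  So of the binomials that generate the kernel only homogeneous ones occur.\<close>

lemma stable_set_ideal_subset_of_homogeneous_binomials:
  assumes G: "simple_graph G" and st: "bij_betw st {1..m} (stable_sets G)"
    and J: "ideal J (mpoly_ring {1..m})"
    and binom: "\<And>(k::nat) i j. i \<in> {1..k} \<rightarrow> {1..m} \<Longrightarrow> j \<in> {1..k} \<rightarrow> {1..m} \<Longrightarrow>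
      (\<Prod>l = 1..k. Var (i l)) - (\<Prod>l = 1..k. Var (j l)) \<in> (stable_set_ideal G m st :: (nat, 'k) mpoly set) \<Longrightarrow>
      (\<Prod>l = 1..k. Var (i l)) - (\<Prod>l = 1..k. Var (j l)) \<in> J"
  shows "(stable_set_ideal G m st :: (nat, 'k::comm_ring_1) mpoly set) \<subseteq> J"
proof
  fix p :: "(nat, 'k) mpoly" assume "p \<in> stable_set_ideal G m st"
  then have p: "p \<in> carrier (mpoly_ring {1..m})" "stable_set_hom st p = 0"
    by (simp_all add: stable_set_ideal_iff)
  have fin: "finite (st v)" if "v \<in> {1..m}" for v
    using st G that by (auto simp: bij_betw_def intro: finite_stable_set)
  have "\<exists>t. stable_set_hom st (Poly_Mapping.single u (1::'k)) = Poly_Mapping.single t 1" for u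
    by (metis monomial_eq_prod_Var stable_set_hom_prod_Var)
  then obtain T where T: "\<And>u. stable_set_hom st (Poly_Mapping.single u (1::'k)) = Poly_Mapping.single (T u) 1"
    by metis
  show "p \<in> J"
  proof (rule kernel_of_monomial_hom_in_ideal[OF J p(1) p(2)[unfolded stable_set_hom_def]])
    show "mpoly_hom (\<lambda>i. Var SVar * (\<Prod>j\<in>st i. Var (TVar j))) (Poly_Mapping.single u (1::'k))
        = Poly_Mapping.single (T u) 1" for u
      using T by (simp add: stable_set_hom_def)
  next
    fix u w assume uw: "Poly_Mapping.keys u \<subseteq> {1..m}" "Poly_Mapping.keys w \<subseteq> {1..m}" "T u = T w"
    obtain k :: nat and i where i: "i \<in> {1..k} \<rightarrow> Poly_Mapping.keys u"
      "Poly_Mapping.single u (1::'k) = (\<Prod>l = 1..k. Var (i l))" by (rule monomial_eq_prod_Var[of u])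
    obtain k' :: nat and j where j: "j \<in> {1..k'} \<rightarrow> Poly_Mapping.keys w"
      "Poly_Mapping.single w (1::'k) = (\<Prod>l = 1..k'. Var (j l))" by (rule monomial_eq_prod_Var[of w])
    have i': "i \<in> {1..k} \<rightarrow> {1..m}" and j': "j \<in> {1..k'} \<rightarrow> {1..m}"
      using i(1) j(1) uw by auto
    have "Poly_Mapping.single (\<Sum>l = 1..k. stable_weight (st (i l))) (1::'k)
        = Poly_Mapping.single (\<Sum>l = 1..k'. stable_weight (st (j l))) 1"
      using T[of u] T[of w] uw(3) by (simp add: i(2) j(2) stable_set_hom_prod_Var)
    then have "(\<Sum>l = 1..k. stable_weight (st (i l))) = (\<Sum>l = 1..k'. stable_weight (st (j l)))"
      by (metis lookup_single_eq lookup_single_not_eq zero_neq_one)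
    then have eq: "card {1..k} = card {1..k'}"
      "\<forall>v. card {l \<in> {1..k}. v \<in> st (i l)} = card {l \<in> {1..k'}. v \<in> st (j l)}"
      using i' j' fin by (subst (asm) sum_stable_weight_eq_iff; auto simp: Pi_def)+
    then have "k' = k" by simp
    with eq i' j' show "Poly_Mapping.single u 1 - Poly_Mapping.single w 1 \<in> J"
      using binom[of i k j] binomial_in_stable_set_ideal_iff[OF G st, of i k j] i(2) j(2) by simp
  qed
qed

lemma chromatic_number_le: "coloring H k f \<Longrightarrow> chromatic_number H \<le> k"
  unfolding chromatic_number_def by (rule Least_le) blast

theorem theorem2p3:
  fixes G :: "nat graph" and n m :: nat and st :: "nat \<Rightarrow> nat set"
  assumes "simple_graph G" and "verts G = {1..n}"
    and "bij_betw st {1..m} (stable_sets G)"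
  shows "(\<forall>k. \<forall>i \<in> {1..k} \<rightarrow> {1..m}. \<forall>j \<in> {1..k} \<rightarrow> {1..m}.
           (\<Prod>l = 1..k. Var (i l)) - (\<Prod>l = 1..k. Var (j l))
              \<in> (stable_set_ideal G m st :: (nat, 'k::field) mpoly set)
           \<longleftrightarrow> (\<exists>a f g. coloring (blowup G a) k f \<and> coloring (blowup G a) k g
                 \<and> coloring_monomial G m st a k f = (\<Prod>l = 1..k. Var (i l) :: (nat, 'k) mpoly)
                 \<and> coloring_monomial G m st a k g = (\<Prod>l = 1..k. Var (j l) :: (nat, 'k) mpoly)))
       \<and> (stable_set_ideal G m st :: (nat, 'k) mpoly set) =
           Idl\<^bsub>mpoly_ring {1..m}\<^esub>
             {coloring_monomial G m st a k f - coloring_monomial G m st a k g | a k f g.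
                coloring (blowup G a) k f \<and> coloring (blowup G a) k g
                \<and> chromatic_number (blowup G a) \<le> k}"
  (is "?binomials \<and> ?I = Idl\<^bsub>?R\<^esub> ?B")
proof
  note G = assms(1) and st = assms(3)
  show ?binomials
  proof (intro allI ballI iffI)
    fix k :: nat and i j assume ij: "i \<in> {1..k} \<rightarrow> {1..m}" "j \<in> {1..k} \<rightarrow> {1..m}"
      and "(\<Prod>l = 1..k. Var (i l)) - (\<Prod>l = 1..k. Var (j l)) \<in> ?I"
    then show "\<exists>a f g. coloring (blowup G a) k f \<and> coloring (blowup G a) k g
        \<and> coloring_monomial G m st a k f = (\<Prod>l = 1..k. Var (i l) :: (nat, 'k) mpoly)
        \<and> coloring_monomial G m st a k g = (\<Prod>l = 1..k. Var (j l) :: (nat, 'k) mpoly)"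
      by (rule colorings_of_binomial[OF G st]) blast
  qed (metis coloring_monomial_diff_in_stable_set_ideal[OF G st])

  have B: "?B \<subseteq> ?I"
    using coloring_monomial_diff_in_stable_set_ideal[OF G st] by blast
  moreover have "?I \<subseteq> carrier ?R"
    by (auto simp: stable_set_ideal_iff)
  ultimately have BR: "?B \<subseteq> carrier ?R" by (rule order_trans)
  show "?I = Idl\<^bsub>?R\<^esub> ?B"
  proof
    show "Idl\<^bsub>?R\<^esub> ?B \<subseteq> ?I"
      by (rule ring.genideal_minimal[OF ring_mpoly_ring ideal_stable_set_ideal[OF G st] B])
    show "?I \<subseteq> Idl\<^bsub>?R\<^esub> ?B"
    proof (rule stable_set_ideal_subset_of_homogeneous_binomials[OF G st])
      show "ideal (Idl\<^bsub>?R\<^esub> ?B) ?R"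
        by (rule ring.genideal_ideal[OF ring_mpoly_ring BR])
    next
      fix k :: nat and i j assume "i \<in> {1..k} \<rightarrow> {1..m}" "j \<in> {1..k} \<rightarrow> {1..m}"
        and "(\<Prod>l = 1..k. Var (i l)) - (\<Prod>l = 1..k. Var (j l)) \<in> ?I"
      then obtain a f g where fg: "coloring (blowup G a) k f" "coloring (blowup G a) k g"
        and monomials: "coloring_monomial G m st a k f = (\<Prod>l = 1..k. Var (i l) :: (nat, 'k) mpoly)"
          "coloring_monomial G m st a k g = (\<Prod>l = 1..k. Var (j l) :: (nat, 'k) mpoly)"
        by (rule colorings_of_binomial[OF G st])
      from fg chromatic_number_le[OF fg(1)]
      have "(\<Prod>l = 1..k. Var (i l)) - (\<Prod>l = 1..k. Var (j l)) \<in> ?B"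
        unfolding monomials[symmetric] by blast
      then show "(\<Prod>l = 1..k. Var (i l)) - (\<Prod>l = 1..k. Var (j l)) \<in> Idl\<^bsub>?R\<^esub> ?B"
        using ring.genideal_self[OF ring_mpoly_ring BR] by blast
    qed
  qed
qed

end
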